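(* If the randomly switched system $\dot x = f_\sigma(x)$, $(x(0),\sigma(0))=(x_0,\sigma_0)$, $t\ge 0$, is globally asymptotically stable almost surely, then it is strongly globally asymptotically stable in probability.
   Context: Setting: $\mathcal P=\{1,\dots,\mathrm N\}$ is a finite index set; for each $i\in\mathcal P$ the vector field $f_i:\mathbb{R}^n\to\mathbb{R}^n$ is locally Lipschitz with $f_i(0)=0$; $\|\cdot\|$ is the Euclidean norm. On a complete probability space $(\Omega,\mathfrak F,\mathsf P)$, the switching signal $\sigma=(\sigma(t))_{t\ge0}$ is a càdlàg $\mathcal P$-valued process with $\sigma(0)=\sigma_0$ deterministic. The state $x$ does not jump at the discontinuities of $\sigma$, and $x(\cdot)$ denotes the (pathwise, Carathéodory, absolutely continuous) solution of the switched system on $[0,\infty[$ for the initial state $x_0$; it depends on $x_0$ and $\omega\in\Omega$. Solutions are assumed to exist globally. Global asymptotic stability almost surely means: (AS1) with probability one, for every $\varepsilon>0$ there is $\delta>0$ such that for every $x_0$, $\|x_0\|<\delta$ implies $\sup_{t\ge0}\|x(t)\|<\varepsilon$; and (AS2) with probability one, for all $r,\varepsilon'>0$ there is $T\ge0$ such that for every $x_0$, $\|x_0\|<r$ implies $\sup_{t\ge T}\|x(t)\|<\varepsilon'$. ($\delta$ and $T$ may depend on $\omega$.) Strong global asymptotic stability in probability means: (i) for every $\eta\in\,]0,1[$ and every $\varepsilon>0$ there is $\delta>0$ such that for every $x_0$, $\|x_0\|<\delta$ implies $\mathsf P\big(\sup_{t\ge0}\|x(t)\|>\varepsilon\big)\le\eta$;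 and (ii) for every $\eta'\in\,]0,1[$ and all $r,\varepsilon'>0$ there is $T>0$ such that for every $x_0$, $\|x_0\|<r$ implies $\mathsf P\big(\sup_{t\ge T}\|x(t)\|>\varepsilon'\big)\le\eta'$. *)

theory Defs
  imports "HOL-Probability.Probability"
begin

(* The values lie in a finite subset of nat, so both limits are limits in the discrete topology. *)
definition cadlag :: "(real \<Rightarrow> nat) \<Rightarrow> bool" where
  "cadlag s \<longleftrightarrow>
     (\<forall>t\<ge>0. continuous (at_right t) s) \<and>
     (\<forall>t>0. \<exists>l. (s \<longlongrightarrow> l) (at_left t))"

(* Absolute continuity of functions; the library constant absolutely_continuous is about measures.
   A finite division D of its own union is a finite family of non-overlapping compact intervals
   K = {Inf K..Sup K}. *)
definition abs_continuous_on :: "real set \<Rightarrow> (real \<Rightarrow> 'b::real_normed_vector) \<Rightarrow> bool" where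
  "abs_continuous_on S F \<longleftrightarrow>
     (\<forall>\<epsilon>>0. \<exists>\<delta>>0. \<forall>D. D division_of \<Union>D \<longrightarrow> \<Union>D \<subseteq> S \<longrightarrow>
        (\<Sum>K\<in>D. Sup K - Inf K) < \<delta> \<longrightarrow>
        (\<Sum>K\<in>D. norm (F (Sup K) - F (Inf K))) < \<epsilon>)"

definition caratheodory_solution ::
    "(nat \<Rightarrow> 'b::real_normed_vector \<Rightarrow> 'b) \<Rightarrow> (real \<Rightarrow> nat) \<Rightarrow> 'b \<Rightarrow> (real \<Rightarrow> 'b) \<Rightarrow> bool" where
  "caratheodory_solution f s x0 x \<longleftrightarrow>
     x 0 = x0 \<and>
     (\<forall>T>0. abs_continuous_on {0..T} x) \<and>
     (AE t in lborel. t \<ge> 0 \<longrightarrow>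
        (x has_vector_derivative f (s t) (x t)) (at t within {0..}))"

definition sup_norm_from :: "real \<Rightarrow> (real \<Rightarrow> 'b::real_normed_vector) \<Rightarrow> ereal" where
  "sup_norm_from T x = (SUP t\<in>{T..}. ereal (norm (x t)))"

(* P(E) \<le> \<eta>, including that E is an event: measure M E is 0 for non-measurable E. *)
definition prob_le :: "'w measure \<Rightarrow> ('w \<Rightarrow> bool) \<Rightarrow> real \<Rightarrow> bool" where
  "prob_le M E \<eta> \<longleftrightarrow>
     {\<omega> \<in> space M. E \<omega>} \<in> sets M \<and> measure M {\<omega> \<in> space M. E \<omega>} \<le> \<eta>"

(* x x0 \<omega> is the solution path with initial state x0 for the outcome \<omega>. *)
definition gas_almost_surely ::
    "'w measure \<Rightarrow> ('b::real_normed_vector \<Rightarrow> 'w \<Rightarrow> real \<Rightarrow> 'b) \<Rightarrow> bool" where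
  "gas_almost_surely M x \<longleftrightarrow>
     (AE \<omega> in M. \<forall>\<epsilon>>0. \<exists>\<delta>>0. \<forall>x0. norm x0 < \<delta> \<longrightarrow>
        sup_norm_from 0 (x x0 \<omega>) < ereal \<epsilon>) \<and>
     (AE \<omega> in M. \<forall>r>0. \<forall>\<epsilon>'>0. \<exists>T\<ge>0. \<forall>x0. norm x0 < r \<longrightarrow>
        sup_norm_from T (x x0 \<omega>) < ereal \<epsilon>')"

definition strongly_gas_in_probability ::
    "'w measure \<Rightarrow> ('b::real_normed_vector \<Rightarrow> 'w \<Rightarrow> real \<Rightarrow> 'b) \<Rightarrow> bool" where
  "strongly_gas_in_probability M x \<longleftrightarrow>
     (\<forall>\<eta>\<in>{0<..<1}. \<forall>\<epsilon>>0. \<exists>\<delta>>0. \<forall>x0. norm x0 < \<delta> \<longrightarrow>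
        prob_le M (\<lambda>\<omega>. sup_norm_from 0 (x x0 \<omega>) > ereal \<epsilon>) \<eta>) \<and>
     (\<forall>\<eta>'\<in>{0<..<1}. \<forall>r>0. \<forall>\<epsilon>'>0. \<exists>T>0. \<forall>x0. norm x0 < r \<longrightarrow>
        prob_le M (\<lambda>\<omega>. sup_norm_from T (x x0 \<omega>) > ereal \<epsilon>') \<eta>')"

end

theory Submission
  imports Defs
begin

text \<open>Uniformity in the initial state is obtained by contradiction. If it failed, there would
  be initial states $y_n$ (with norms tending to 0 in part (i), bounded by $r$ and observed from time
  $n$ on in part (ii)) whose bad events all have probability greater than $\eta$; but almost
  surely only finitely many of these events occur, so their probabilities tend to 0. No regularity
  in the initial state is needed.

  That the bad events are measurable follows, by continuity of the paths, from the measurability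
  of the state at each fixed time. The latter holds because the solution is the pathwise limit of
  explicit Euler polygons, each of which depends on the switching signal at finitely many times
  only.\<close>

section \<open>Absolutely continuous curves\<close>

text \<open>A division with only one member, the interval between two nearby points, already yields
  the usual estimate.\<close>

lemma abs_continuous_on_imp_continuous_on:
  fixes F :: "real \<Rightarrow> 'b::real_normed_vector"
  assumes "abs_continuous_on {a..b} F"
  shows "continuous_on {a..b} F"
  unfolding continuous_on_iff
proof (intro ballI allI impI)
  fix t \<epsilon> :: real
  assume t: "t \<in> {a..b}" and "\<epsilon> > 0"
  then obtain \<delta> where "\<delta> > 0" and
    \<delta>: "\<And>D. \<lbrakk>D division_of \<Union>D; \<Union>D \<subseteq> {a..b}; (\<Sum>K\<in>D. Sup K - Inf K) < \<delta>\<rbrakk> \<Longrightarrow>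
          (\<Sum>K\<in>D. norm (F (Sup K) - F (Inf K))) < \<epsilon>"
    using assms unfolding abs_continuous_on_def by meson
  have step: "norm (F v - F u) < \<epsilon>" if "u \<le> v" "u \<in> {a..b}" "v \<in> {a..b}" "v - u < \<delta>" for u v
  proof -
    have "{cbox u v} division_of cbox u v"
      using that by (intro division_of_self) (auto simp: box_ne_empty)
    then show ?thesis
      using \<delta>[of "{{u..v}}"] that by auto
  qed
  show "\<exists>d>0. \<forall>t'\<in>{a..b}. dist t' t < d \<longrightarrow> dist (F t') (F t) < \<epsilon>"
  proof (intro exI[of _ \<delta>] conjI ballI impI)
    fix t' assume "t' \<in> {a..b}" "dist t' t < \<delta>"
    then show "dist (F t') (F t) < \<epsilon>"
      using step[of t t'] step[of t' t] t
      by (cases "t \<le> t'") (auto simp: dist_norm norm_minus_commute)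
  qed fact
qed

text \<open>At tags in the exceptional null set the gauge is an open superset of small measure;
  absolute continuity controls the increments there.\<close>

theorem fundamental_theorem_of_calculus_abs_continuous:
  fixes F :: "real \<Rightarrow> 'b::banach"
  assumes "a \<le> b"
    and ac: "abs_continuous_on {a..b} F"
    and deriv: "AE t in lborel. t \<in> {a..b} \<longrightarrow> (F has_vector_derivative g t) (at t within {a..b})"
  shows "(g has_integral (F b - F a)) {a..b}"
proof -
  obtain N where N: "N \<in> null_sets lborel"
    and der': "\<And>t. t \<in> space lborel - N \<Longrightarrow>
      t \<in> {a..b} \<longrightarrow> (F has_vector_derivative g t) (at t within {a..b})"
    using AE_E3[OF deriv] by metis
  have der: "(F has_vector_derivative g t) (at t within {a..b})" if "t \<in> {a..b} - N" for t
    using der'[of t] that by simp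
  have "negligible N"
    using N by (simp add: negligible_iff_null_sets null_sets_completionI)
  \<comment> \<open>Tags in \<open>N\<close> now contribute 0 to the Riemann sums, so only the
    increments of \<open>F\<close> remain to be controlled there. The integral of \<open>g\<close>
    is recovered at the end, since \<open>g\<close> and \<open>g'\<close> differ on a negligible set
    only.\<close>
  define g' where "g' t = (if t \<in> N then 0 else g t)" for t
  have "(g' has_integral (F b - F a)) (cbox a b)"
    unfolding has_integral
  proof (intro allI impI)
    fix e :: real assume "e > 0"
    \<comment> \<open>One half of \<open>e\<close> is spent on tags outside \<open>N\<close>, the
      other half on tags in \<open>N\<close>. The \<open>+ 1\<close> keeps the denominator positive
      when \<open>a = b\<close>.\<close>
    define c where "c = e / (2 * (b - a + 1))"
    have "c > 0" and c: "c * (b - a) \<le> e / 2"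
      using \<open>e > 0\<close> \<open>a \<le> b\<close> by (auto simp: c_def field_simps)
    obtain \<delta> where "\<delta> > 0" and
      \<delta>: "\<And>D. \<lbrakk>D division_of \<Union>D; \<Union>D \<subseteq> {a..b}; (\<Sum>K\<in>D. Sup K - Inf K) < \<delta>\<rbrakk> \<Longrightarrow>
            (\<Sum>K\<in>D. norm (F (Sup K) - F (Inf K))) < e / 2"
      using ac \<open>e > 0\<close> half_gt_zero[OF \<open>e > 0\<close>]
      unfolding abs_continuous_on_def by meson
    obtain U where U: "open U" "N \<subseteq> U" "emeasure lborel (U - N) < \<delta>"
      using outer_regular_lborel[of N \<delta>] N \<open>\<delta> > 0\<close> by (auto simp: null_sets_def)
    have emU: "emeasure lborel U < \<delta>"
    proof -
      have "emeasure lborel (U - N) = emeasure lborel U"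
        using U N by (intro emeasure_Diff_null_set) auto
      then show ?thesis
        using U by simp
    qed
    have "\<exists>d>0. t \<in> {a..b} - N \<longrightarrow>
         (\<forall>y\<in>{a..b}. norm (y - t) < d \<longrightarrow> norm (F y - F t - (y - t) *\<^sub>R g t) \<le> c * norm (y - t))" for t
    proof (cases "t \<in> {a..b} - N")
      case True
      show ?thesis
        using der[OF True, unfolded has_vector_derivative_def has_derivative_within_alt] \<open>c > 0\<close>
        by blast
    qed (use zero_less_one in blast)
    then obtain d where d: "\<And>t. 0 < d t"
      "\<And>t y. \<lbrakk>t \<in> {a..b} - N; y \<in> {a..b}; norm (y - t) < d t\<rbrakk>
          \<Longrightarrow> norm (F y - F t - (y - t) *\<^sub>R g t) \<le> c * norm (y - t)"
      by metis
    define \<gamma> where "\<gamma> t = (if t \<in> N then U else ball t (d t))" for t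
    have "gauge \<gamma>"
      using U d(1) by (auto simp: gauge_def \<gamma>_def)
    moreover have "norm ((\<Sum>(t, K)\<in>p. measure lborel K *\<^sub>R g' t) - (F b - F a)) < e"
      if p: "p tagged_division_of cbox a b" and fine: "\<gamma> fine p" for p
    proof -
      have inc: "b - a = (\<Sum>(t, K)\<in>p. Sup K - Inf K)" "F b - F a = (\<Sum>(t, K)\<in>p. F (Sup K) - F (Inf K))"
        using additive_tagged_division_1[where f = "\<lambda>x. x"] additive_tagged_division_1[where f = F]
          \<open>a \<le> b\<close> p by auto
      have "finite p"
        using p by blast
      define q where "q = {(t, K) \<in> p. t \<in> N}"
      have "q \<subseteq> p"
        by (auto simp: q_def)
      have bound: "norm (measure lborel K *\<^sub>R g' t - (F (Sup K) - F (Inf K)))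
          \<le> c * (Sup K - Inf K) + (if t \<in> N then norm (F (Sup K) - F (Inf K)) else 0)"
        if tK: "(t, K) \<in> p" for t K
      proof -
        obtain u v where K: "K = {u..v}" and t: "t \<in> K" and sub: "K \<subseteq> {a..b}"
          using p tK by (metis box_real(2) tagged_division_ofD(2-4))
        have uv: "u \<le> v" "Sup K = v" "Inf K = u" "u \<in> K" "v \<in> K"
          using t by (auto simp: K)
        show ?thesis
        proof (cases "t \<in> N")
          case True
          then show ?thesis
            using uv \<open>c > 0\<close> by (simp add: g'_def norm_minus_commute)
        next
          case False
          then have near: "K \<subseteq> ball t (d t)"
            using fine tK unfolding fine_def \<gamma>_def by force
          \<comment> \<open>Straddle argument: the tag lies between \<open>u\<close> and
            \<open>v\<close>, so the linearisation errors at the two end points add up to exactly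
            \<open>c * (v - u)\<close>.\<close>
          have "norm ((v - u) *\<^sub>R g t - (F v - F u))
              = norm ((F u - F t - (u - t) *\<^sub>R g t) - (F v - F t - (v - t) *\<^sub>R g t))"
            by (auto simp: algebra_simps)
          also have "\<dots> \<le> norm (F u - F t - (u - t) *\<^sub>R g t) + norm (F v - F t - (v - t) *\<^sub>R g t)"
            by (rule norm_triangle_ineq4)
          also have "\<dots> \<le> c * norm (u - t) + c * norm (v - t)"
          proof (intro add_mono d(2))
            show "norm (u - t) < d t" "norm (v - t) < d t"
              using near uv by (force simp: dist_real_def)+
          qed (use t sub uv False in auto)
          also have "\<dots> = c * (v - u)"
            using t by (simp add: K field_simps)
          finally show ?thesis
            using False uv by (simp add: g'_def K)
        qed
      qed
      have q: "q tagged_division_of \<Union>(snd ` q)"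
        using tagged_partial_division_of_Union_self tagged_partial_division_subset \<open>q \<subseteq> p\<close> p
        by (metis tagged_division_of_def)
      then have div: "snd ` q division_of \<Union>(snd ` q)"
        by (rule division_of_tagged_division)
      \<comment> \<open>The intervals do not overlap, so their total length is the measure of their
        union, and fineness puts this union inside \<open>U\<close>.\<close>
      have "(\<Sum>K\<in>snd ` q. Sup K - Inf K) = sum (measure lebesgue) (snd ` q)"
      proof (rule sum.cong)
        fix K assume "K \<in> snd ` q"
        then obtain u v where "K = cbox u v" "K \<noteq> {}"
          using div by (metis division_ofD(3,4))
        then show "Sup K - Inf K = measure lebesgue K"
          by auto
      qed simp
      also have "\<dots> = measure lebesgue (\<Union>(snd ` q))"
        using content_division[OF div] by simp
      also have "\<dots> < \<delta>"
      proof -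
        have "\<Union>(snd ` q) \<subseteq> U"
          using fine unfolding fine_def \<gamma>_def q_def by force
        then have "emeasure lebesgue (\<Union>(snd ` q)) \<le> emeasure lebesgue U"
          using U by (intro emeasure_mono) auto
        also have "\<dots> < \<delta>"
          using emU U by simp
        finally show ?thesis
          using \<open>\<delta> > 0\<close> unfolding measure_def by (subst enn2real_less_iff) (auto intro: order.strict_trans)
      qed
      finally have "(\<Sum>K\<in>snd ` q. norm (F (Sup K) - F (Inf K))) < e / 2"
      proof (intro \<delta> div)
        show "\<Union>(snd ` q) \<subseteq> {a..b}"
          using p \<open>q \<subseteq> p\<close> by (force dest: tagged_division_ofD(3))
      qed 
      \<comment> \<open>The case distinction is needed because \<open>Sup {}\<close> and \<open>Inf {}\<close> are unspecified.\<close>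
      also have "(\<Sum>K\<in>snd ` q. norm (F (Sup K) - F (Inf K)))
          = (\<Sum>K\<in>snd ` q. if K = {} then 0 else norm (F (Sup K) - F (Inf K)))"
        using div by (intro sum.cong) auto
      \<comment> \<open>Different tags may share an interval only if its interior is empty; the
        summand then vanishes, so summing over pairs or over intervals gives the same value.\<close>
      also have "\<dots> = (\<Sum>(t, K)\<in>q. if K = {} then 0 else norm (F (Sup K) - F (Inf K)))"
      proof (rule sum.over_tagged_division_lemma[OF q, symmetric])
        fix u v :: real assume "box u v = {}"
        then have "u \<ge> v"
          by auto
        then show "(if cbox u v = {} then 0 else norm (F (Sup (cbox u v)) - F (Inf (cbox u v)))) = 0"
          by (cases "u = v") auto
      qed
      also have "\<dots> = (\<Sum>(t, K)\<in>q. norm (F (Sup K) - F (Inf K)))"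
        using division_ofD(3)[OF div] by (intro sum.cong) force+
      also have "\<dots> = (\<Sum>(t, K)\<in>p. if t \<in> N then norm (F (Sup K) - F (Inf K)) else 0)"
        using \<open>finite p\<close> unfolding q_def
        by (intro sum.mono_neutral_cong_left) (auto split: if_splits)
      finally have small: "(\<Sum>(t, K)\<in>p. if t \<in> N then norm (F (Sup K) - F (Inf K)) else 0) < e / 2" .
      have "norm ((\<Sum>(t, K)\<in>p. measure lborel K *\<^sub>R g' t) - (F b - F a))
          = norm (\<Sum>(t, K)\<in>p. measure lborel K *\<^sub>R g' t - (F (Sup K) - F (Inf K)))"
        by (simp add: inc(2) sum_subtractf split_def)
      also have "\<dots> \<le> (\<Sum>(t, K)\<in>p. c * (Sup K - Inf K) + (if t \<in> N then norm (F (Sup K) - F (Inf K)) else 0))"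
        using bound by (intro sum_norm_le) auto
      also have "\<dots> = c * (b - a) + (\<Sum>(t, K)\<in>p. if t \<in> N then norm (F (Sup K) - F (Inf K)) else 0)"
        by (simp add: inc(1) sum.distrib split_def sum_distrib_left)
      finally show ?thesis
        using c small by linarith
    qed
    ultimately show "\<exists>\<gamma>. gauge \<gamma> \<and> (\<forall>p. p tagged_division_of cbox a b \<and> \<gamma> fine p \<longrightarrow>
        norm ((\<Sum>(t, K)\<in>p. measure lborel K *\<^sub>R g' t) - (F b - F a)) < e)"
      by (intro exI[of _ \<gamma>] conjI allI impI) simp_all
  qed
  then have "(g' has_integral (F b - F a)) {a..b}"
    by simp
  then show ?thesis
    by (rule has_integral_spike[OF \<open>negligible N\<close>, rotated]) (simp add: g'_def)
qed

section \<open>Continuity and integral form of Caratheodory solutions\<close>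

lemma caratheodory_solution_continuous_on:
  fixes x :: "real \<Rightarrow> 'b::real_normed_vector"
  assumes "caratheodory_solution f s x0 x"
  shows "continuous_on {0..} x"
  unfolding continuous_on_eq_continuous_within
proof
  fix t :: real assume "t \<in> {0..}"
  \<comment> \<open>Absolute continuity is available on bounded intervals only. The window reaches
    beyond \<open>t\<close>, so within it \<open>t\<close> has the same neighbourhoods as in
    \<open>{0..}\<close>.\<close>
  have "continuous_on {0..t + 1} x"
    using assms \<open>t \<in> {0..}\<close>
    by (intro abs_continuous_on_imp_continuous_on) (auto simp: caratheodory_solution_def)
  then have "continuous (at t within {0..t + 1}) x"
    using \<open>t \<in> {0..}\<close> by (auto simp: continuous_on_eq_continuous_within)
  moreover have "at t within {0..t + 1} = at t within {0..}"
    using \<open>t \<in> {0..}\<close> by (intro at_within_nhd[of _ "{..<t + 1}"]) auto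
  ultimately show "continuous (at t within {0..}) x"
    by simp
qed

lemma caratheodory_solution_has_integral:
  fixes x :: "real \<Rightarrow> 'b::banach"
  assumes "caratheodory_solution f s x0 x" and "0 \<le> a" "a \<le> b"
  shows "((\<lambda>t. f (s t) (x t)) has_integral (x b - x a)) {a..b}"
proof (rule fundamental_theorem_of_calculus_abs_continuous[OF \<open>a \<le> b\<close>])
  \<comment> \<open>The right end \<open>b + 1\<close> is positive even if \<open>b = 0\<close>, as
    the definition requires.\<close>
  have "abs_continuous_on {0..b + 1} x"
    using assms by (auto simp: caratheodory_solution_def)
  moreover have "{a..b} \<subseteq> {0..b + 1}"
    using assms by auto
  ultimately show "abs_continuous_on {a..b} x"
    unfolding abs_continuous_on_def by (meson order_trans)
  have "AE t in lborel. t \<ge> 0 \<longrightarrow> (x has_vector_derivative f (s t) (x t)) (at t within {0..})"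
    using assms(1) by (simp add: caratheodory_solution_def)
  then show "AE t in lborel. t \<in> {a..b} \<longrightarrow>
      (x has_vector_derivative f (s t) (x t)) (at t within {a..b})"
  proof eventually_elim
    case (elim t)
    then show ?case
      using \<open>0 \<le> a\<close> by (auto intro: has_vector_derivative_within_subset)
  qed
qed

section \<open>Euler polygons\<close>

text \<open>The signal enters only through its samples \<open>c\<close>, so that a polygon depends
  on finitely many random modes. Step \<open>k\<close> uses the sample with index
  \<open>Suc k\<close>, taken at the right end of the step.\<close>

primrec euler :: "(nat \<Rightarrow> 'b::real_vector \<Rightarrow> 'b) \<Rightarrow> (nat \<Rightarrow> nat) \<Rightarrow> real \<Rightarrow> 'b \<Rightarrow> nat \<Rightarrow> 'b" where
  "euler f c h y 0 = y"
| "euler f c h y (Suc k) = euler f c h y k + h *\<^sub>R f (c (Suc k)) (euler f c h y k)"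

text \<open>The random mode takes countably many values, so it suffices to treat each fixed mode
  \<open>i\<close>, where a measurable point is composed with the continuous map
  \<open>f i\<close>.\<close>

lemma borel_measurable_euler:
  fixes f :: "nat \<Rightarrow> 'b::euclidean_space \<Rightarrow> 'b"
  assumes f: "\<And>i. i \<in> P \<Longrightarrow> continuous_on UNIV (f i)"
    and c: "\<And>k. c k \<in> M \<rightarrow>\<^sub>M count_space P"
  shows "(\<lambda>\<omega>. euler f (\<lambda>k. c k \<omega>) h y n) \<in> borel_measurable M"
proof (induction n)
  case (Suc n)
  have "(\<lambda>\<omega>. f (c (Suc n) \<omega>) (euler f (\<lambda>k. c k \<omega>) h y n)) \<in> borel_measurable M"
  proof (rule measurable_compose_countable'[OF _ c])
    fix i assume "i \<in> P"
    show "(\<lambda>\<omega>. f i (euler f (\<lambda>k. c k \<omega>) h y n)) \<in> borel_measurable M"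
      using measurable_compose[OF Suc borel_measurable_continuous_onI[OF f[OF \<open>i \<in> P\<close>]]] .
  qed simp
  then show ?case
    using Suc by simp
qed simp

text \<open>Vector fields that are only locally Lipschitz suffice, because a small
  total defect keeps the Euler points within distance 1 of the curve.\<close>

lemma euler_error_bound:
  fixes f :: "nat \<Rightarrow> 'b::real_normed_vector \<Rightarrow> 'b"
  assumes "h \<ge> 0" and "L \<ge> 0"
    and lip: "\<And>i. i \<in> P \<Longrightarrow> L-lipschitz_on (cball 0 (R + 1)) (f i)"
    and c: "\<And>k. c k \<in> P"
    and X: "\<And>k. k \<le> n \<Longrightarrow> norm (X k) \<le> R"
    and defect: "\<And>k. k < n \<Longrightarrow> norm (X (Suc k) - X k - h *\<^sub>R f (c (Suc k)) (X k)) \<le> E k"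
    and small: "exp (L * (real n * h)) * (\<Sum>k<n. E k) \<le> 1"
    and "k \<le> n"
  shows "norm (euler f c h (X 0) k - X k) \<le> exp (L * (real k * h)) * (\<Sum>j<k. E j)"
  using \<open>k \<le> n\<close>
proof (induction k)
  case (Suc k)
  let ?Y = "euler f c h (X 0)" and ?I = "\<lambda>k. \<Sum>j<k. E j"
  have E_nonneg: "E j \<ge> 0" if "j < n" for j
    using defect[OF that] norm_ge_zero order_trans by blast
  have I_nonneg: "?I k \<ge> 0"
    using E_nonneg Suc.prems by (intro sum_nonneg) auto
  have IH: "norm (?Y k - X k) \<le> exp (L * (real k * h)) * ?I k"
    using Suc by simp
  also have "\<dots> \<le> exp (L * (real n * h)) * ?I n"
    using Suc.prems assms(1,2) E_nonneg I_nonneg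
    by (intro mult_mono sum_mono2) (auto intro!: mult_left_mono mult_right_mono)
  also have "\<dots> \<le> 1"
    by (rule small)
  finally have "norm (?Y k) \<le> R + 1" "norm (X k) \<le> R + 1"
    using X[of k] Suc.prems norm_triangle_sub[of "?Y k" "X k"] by auto
  then have lip': "norm (f (c (Suc k)) (?Y k) - f (c (Suc k)) (X k)) \<le> L * norm (?Y k - X k)"
    using lipschitz_onD[OF lip[OF c], of "?Y k" "X k" "Suc k"] by (simp add: dist_norm)
  have "norm (?Y (Suc k) - X (Suc k))
      = norm ((?Y k - X k) + h *\<^sub>R (f (c (Suc k)) (?Y k) - f (c (Suc k)) (X k))
        - (X (Suc k) - X k - h *\<^sub>R f (c (Suc k)) (X k)))"
    by (simp add: scaleR_diff_right)
  also have "\<dots> \<le> norm (?Y k - X k) + norm (h *\<^sub>R (f (c (Suc k)) (?Y k) - f (c (Suc k)) (X k)))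
      + norm (X (Suc k) - X k - h *\<^sub>R f (c (Suc k)) (X k))"
    by (rule order_trans[OF norm_triangle_ineq4 add_right_mono[OF norm_triangle_ineq]])
  also have "\<dots> \<le> norm (?Y k - X k) + h * (L * norm (?Y k - X k)) + E k"
  proof (intro add_mono order_refl)
    show "norm (h *\<^sub>R (f (c (Suc k)) (?Y k) - f (c (Suc k)) (X k))) \<le> h * (L * norm (?Y k - X k))"
      using mult_left_mono[OF lip' \<open>h \<ge> 0\<close>] by (simp only: norm_scaleR abs_of_nonneg[OF \<open>h \<ge> 0\<close>])
    show "norm (X (Suc k) - X k - h *\<^sub>R f (c (Suc k)) (X k)) \<le> E k"
      using defect[of k] Suc.prems by simp
  qed
  also have "\<dots> = (1 + L * h) * norm (?Y k - X k) + E k"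
    by (simp add: algebra_simps)
  \<comment> \<open>Discrete Gronwall step: \<open>1 + L * h\<close> is at most
    \<open>exp (L * h)\<close>, and the new defect is inflated by an exponential factor of at least
    1 so that both terms carry the same weight.\<close>
  also have "\<dots> \<le> exp (L * h) * (exp (L * (real k * h)) * ?I k) + exp (L * (real (Suc k) * h)) * E k"
  proof (intro add_mono mult_mono IH exp_ge_add_one_self)
    have "1 \<le> exp (L * (real (Suc k) * h))"
      using assms(1,2) by simp
    then show "E k \<le> exp (L * (real (Suc k) * h)) * E k"
      using E_nonneg[of k] Suc.prems mult_right_mono[of 1 "exp (L * (real (Suc k) * h))" "E k"] by simp
  qed simp_all
  also have "\<dots> = exp (L * (real (Suc k) * h)) * ?I (Suc k)"
  proof -
    have "exp (L * h) * exp (L * (real k * h)) = exp (L * (real (Suc k) * h))"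
      by (simp add: exp_add[symmetric] algebra_simps)
    then show ?thesis
      by (simp only: sum.lessThan_Suc distrib_left mult.assoc[symmetric])
  qed
  finally show ?case .
qed simp

section \<open>Convergence of the Euler polygons to the solution\<close>

lemma continuous_at_right_imp_right_limits:
  fixes u :: "nat \<Rightarrow> real"
  assumes "continuous (at_right t) s" "u \<longlonglongrightarrow> t" "\<forall>\<^sub>F n in sequentially. u n > t"
  shows "(\<lambda>n. s (u n)) \<longlonglongrightarrow> s t"
proof -
  have "filterlim u (at_right t) sequentially"
    using assms(2,3) by (auto simp: filterlim_at elim: eventually_mono)
  then show ?thesis
    using assms(1) unfolding continuous_within by (metis filterlim_compose)
qed

text \<open>The last grid point not beyond \<open>r\<close> lies within one mesh width
  \<open>T / real n\<close> of \<open>r\<close>.\<close>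

lemma tendsto_floor_grid:
  fixes r T :: real
  assumes "T > 0"
  shows "(\<lambda>n. real_of_int \<lfloor>r * real n / T\<rfloor> * (T / real n)) \<longlonglongrightarrow> r"
proof (rule tendsto_sandwich)
  have ev: "\<forall>\<^sub>F n::nat in sequentially. n > 0"
    by (rule eventually_gt_at_top)
  then show "\<forall>\<^sub>F n in sequentially. r - T / real n \<le> real_of_int \<lfloor>r * real n / T\<rfloor> * (T / real n)"
  proof eventually_elim
    case (elim n)
    have "r - T / real n = (r * real n / T - 1) * (T / real n)"
      using elim assms by (simp add: field_simps)
    also have "\<dots> \<le> real_of_int \<lfloor>r * real n / T\<rfloor> * (T / real n)"
      using assms by (intro mult_right_mono) (linarith, simp)
    finally show ?case .
  qed
  show "\<forall>\<^sub>F n in sequentially. real_of_int \<lfloor>r * real n / T\<rfloor> * (T / real n) \<le> r"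
    using ev
  proof eventually_elim
    case (elim n)
    have "real_of_int \<lfloor>r * real n / T\<rfloor> * (T / real n) \<le> (r * real n / T) * (T / real n)"
      using assms by (intro mult_right_mono) (linarith, simp)
    also have "\<dots> = r"
      using elim assms by simp
    finally show ?case .
  qed
  have "(\<lambda>n. T / real n) \<longlonglongrightarrow> 0"
    by (rule lim_const_over_n)
  from tendsto_diff[OF tendsto_const this]
  show "(\<lambda>n. r - T / real n) \<longlonglongrightarrow> r"
    by simp
qed simp

text \<open>The defect of a step is the integral of \<open>g - w n k\<close> over it. Hence the
  defects are bounded in total by the integral over \<open>{0..T}\<close> of the distance between
  \<open>g\<close> and the step function, which tends to 0 by dominated convergence.\<close>

lemma step_function_defect_tendsto_0:
  fixes g X :: "real \<Rightarrow> 'b::euclidean_space" and w :: "nat \<Rightarrow> nat \<Rightarrow> 'b"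
  assumes "T > 0"
    and int: "\<And>a b. \<lbrakk>0 \<le> a; a \<le> b; b \<le> T\<rbrakk> \<Longrightarrow> (g has_integral (X b - X a)) {a..b}"
    and lim: "\<And>r. r \<in> {0..T} \<Longrightarrow> (\<lambda>n. w n (nat \<lfloor>r * real n / T\<rfloor>)) \<longlonglongrightarrow> g r"
    and bnd: "\<And>n k. k \<le> n \<Longrightarrow> norm (w n k) \<le> B"
  obtains E :: "nat \<Rightarrow> nat \<Rightarrow> real"
  where "\<And>n k. k < n \<Longrightarrow> norm (X (real (Suc k) * (T / real n)) - X (real k * (T / real n)) - (T / real n) *\<^sub>R w n k) \<le> E n k"
    and "(\<lambda>n. \<Sum>k<n. E n k) \<longlonglongrightarrow> 0"
proof -
  define W where "W n r = w n (nat \<lfloor>r * real n / T\<rfloor>)" for n r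
  define D where "D n r = norm (W n r - g r)" for n r
  define t where "t n k = real k * (T / real n)" for n k
  define E where "E n k = integral {t n k..t n (Suc k)} (D n)" for n k
  \<comment> \<open>At \<open>r = T\<close> the index is \<open>n\<close>, one past the last step;
    the bound on \<open>w n k\<close> therefore has to include \<open>k = n\<close>.\<close>
  have W_bound: "norm (W n r) \<le> B" if "r \<in> {0..T}" for n r
  proof -
    have "r * real n / T \<le> T * real n / T"
      using that \<open>T > 0\<close> by (intro divide_right_mono mult_right_mono) auto
    then have "nat \<lfloor>r * real n / T\<rfloor> \<le> n"
      using \<open>T > 0\<close> by (simp add: nat_le_iff floor_le_iff)
    then show ?thesis
      using bnd by (simp add: W_def)
  qed
  have W_lim: "(\<lambda>n. W n r) \<longlonglongrightarrow> g r" if "r \<in> {0..T}" for r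
    using lim[OF that] by (simp add: W_def)
  \<comment> \<open>No bound on \<open>g\<close> is assumed; it is inherited from the pointwise
    limit.\<close>
  have g_bound: "norm (g r) \<le> B" if "r \<in> {0..T}" for r
    using Lim_norm_ubound[OF _ W_lim[OF that]] W_bound[OF that] by auto
  have D_bound: "norm (D n r) \<le> 2 * B" if "r \<in> {0..T}" for n r
    using norm_triangle_ineq4[of "W n r" "g r"] W_bound[OF that, of n] g_bound[OF that]
    by (simp add: D_def)
  have D_int: "D n integrable_on {0..T}" for n
  proof (rule measurable_bounded_by_integrable_imp_integrable)
    have "W n \<in> borel_measurable borel"
      unfolding W_def by measurable
    then have "W n \<in> borel_measurable (lebesgue_on {0..T})"
      by (intro measurable_restrict_space1 measurable_completion) simp
    moreover have "g \<in> borel_measurable (lebesgue_on {0..T})"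
      using int[of 0 T] \<open>T > 0\<close> by (intro integrable_imp_measurable) auto
    ultimately show "D n \<in> borel_measurable (lebesgue_on {0..T})"
      unfolding D_def by measurable
    show "(\<lambda>_. 2 * B) integrable_on {0..T}"
      by (rule integrable_const_ivl)
  qed (use D_bound in auto)
  have "(\<lambda>n. integral {0..T} (D n)) \<longlonglongrightarrow> integral {0..T} (\<lambda>_. 0)"
  proof (rule dominated_convergence(2)[OF D_int])
    show "(\<lambda>_. 2 * B) integrable_on {0..T}"
      by (rule integrable_const_ivl)
    show "norm (D n r) \<le> 2 * B" if "r \<in> {0..T}" for n r
      using D_bound that .
    show "(\<lambda>n. D n r) \<longlonglongrightarrow> 0" if "r \<in> {0..T}" for r
      using tendsto_norm[OF tendsto_diff[OF W_lim[OF that] tendsto_const[of "g r"]]] by (simp add: D_def)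
  qed
  then have D_lim: "(\<lambda>n. integral {0..T} (D n)) \<longlonglongrightarrow> 0"
    by simp
  have t_mono: "t n k \<le> t n (Suc k)" for n k
    using \<open>T > 0\<close> unfolding t_def by (intro mult_right_mono) auto
  have t_range: "0 \<le> t n k" "t n k \<le> T" if "k \<le> n" for n k
  proof -
    have "real k * (T / real n) \<le> real n * (T / real n)"
      using that \<open>T > 0\<close> by (intro mult_right_mono) auto
    then show "0 \<le> t n k" "t n k \<le> T"
      using \<open>T > 0\<close> by (auto simp: t_def split: if_splits)
  qed
  have "norm (X (t n (Suc k)) - X (t n k) - (T / real n) *\<^sub>R w n k) \<le> E n k" if "k < n" for n k
  proof -
    let ?J = "{t n k..t n (Suc k)}"
    have sub: "?J \<subseteq> {0..T}"
      using t_range[of k n] t_range[of "Suc k" n] that by auto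
    \<comment> \<open>At the right end point the floor has already jumped to \<open>k + 1\<close>.
      This single point is negligible for the integrals below.\<close>
    have W_eq: "W n r = w n k" if "r \<in> ?J - {t n (Suc k)}" for r
    proof -
      have "real k \<le> r * real n / T" "r * real n / T < real k + 1"
        using that \<open>k < n\<close> \<open>T > 0\<close> by (auto simp: t_def field_simps)
      then have "\<lfloor>r * real n / T\<rfloor> = int k"
        by (intro floor_unique) auto
      then show ?thesis
        by (simp add: W_def)
    qed
    have "((\<lambda>r. g r - w n k) has_integral (X (t n (Suc k)) - X (t n k) - (t n (Suc k) - t n k) *\<^sub>R w n k)) ?J"
      using int[of "t n k" "t n (Suc k)"] has_integral_const_real[of "w n k" "t n k" "t n (Suc k)"]
        t_range[of k n] t_range[of "Suc k" n] that t_mono[of n k]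
      by (intro has_integral_diff) auto
    moreover have "t n (Suc k) - t n k = T / real n"
      by (simp add: t_def algebra_simps add_divide_distrib)
    ultimately have hi: "((\<lambda>r. g r - w n k) has_integral (X (t n (Suc k)) - X (t n k) - (T / real n) *\<^sub>R w n k)) ?J"
      by simp
    have DJ: "D n integrable_on ?J"
      using integrable_on_subinterval[OF D_int sub] .
    have "norm (integral ?J (\<lambda>r. g r - w n k)) \<le> integral ?J (\<lambda>r. norm (g r - w n k))"
    proof (rule integral_norm_bound_integral)
      show "(\<lambda>r. norm (g r - w n k)) integrable_on ?J"
        using integrable_spike[OF DJ negligible_sing[of "t n (Suc k)"]] W_eq
        by (auto simp: D_def norm_minus_commute)
    qed (use hi in auto)
    also have "\<dots> = E n k"
      unfolding E_def using W_eq
      by (intro integral_spike[OF negligible_sing[of "t n (Suc k)"]]) (auto simp: D_def norm_minus_commute)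
    finally show ?thesis
      using integral_unique[OF hi] by simp
  qed
  moreover have "(\<Sum>k<m. E n k) = integral {0..t n m} (D n)" if "m \<le> n" for n m
    using that
  proof (induction m)
    case (Suc m)
    have "D n integrable_on {0..t n (Suc m)}"
      using t_range[OF Suc.prems] by (intro integrable_on_subinterval[OF D_int]) auto
    then have "integral {0..t n m} (D n) + E n m = integral {0..t n (Suc m)} (D n)"
      unfolding E_def using t_range[of m n] Suc.prems t_mono
      by (intro Henstock_Kurzweil_Integration.integral_combine) auto
    then show ?case
      using Suc by simp
  qed (simp add: t_def)
  \<comment> \<open>For \<open>n = 0\<close> the mesh is 0 by the convention on division, and the
    grid does not reach \<open>T\<close>.\<close>
  then have "(\<Sum>k<n. E n k) = integral {0..T} (D n)" if "n > 0" for n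
    using that by (simp add: t_def)
  then have "(\<lambda>n. \<Sum>k<n. E n k) \<longlonglongrightarrow> 0"
    by (intro Lim_transform_eventually[OF D_lim] eventually_mono[OF eventually_gt_at_top[of 0]]) simp
  ultimately show thesis
    by (intro that[of E]) (auto simp: t_def)
qed

text \<open>\<open>local_lipschitz\<close> carries a time parameter. Restricting it to the single
  time 0 makes the time domain compact as well.\<close>

lemma local_lipschitz_imp_lipschitz_on_compact:
  fixes f :: "'b::{metric_space, heine_borel} \<Rightarrow> 'c::metric_space"
  assumes "local_lipschitz (UNIV :: real set) UNIV (\<lambda>_. f)" "compact K"
  obtains L where "L-lipschitz_on K f"
proof -
  have "local_lipschitz {0 :: real} K (\<lambda>_. f)"
    using local_lipschitz_subset[OF assms(1)] by blast
  then show thesis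
    using local_lipschitz_compact_implies_lipschitz[of "{0 :: real}" K "\<lambda>_. f"] assms(2) that by auto
qed

text \<open>Evaluating the mode at the right end point of each step makes the step
  functions converge at every time, since the mode is right-continuous.\<close>

lemma euler_tendsto_solution:
  fixes f :: "nat \<Rightarrow> 'b::euclidean_space \<Rightarrow> 'b"
  assumes "T > 0" and "finite P"
    and s: "\<And>t. t \<ge> 0 \<Longrightarrow> s t \<in> P"
    and s_right: "\<And>t. t \<ge> 0 \<Longrightarrow> continuous (at_right t) s"
    and f: "\<And>i. i \<in> P \<Longrightarrow> local_lipschitz (UNIV :: real set) UNIV (\<lambda>_. f i)"
    and sol: "caratheodory_solution f s x0 x"
  shows "(\<lambda>n. euler f (\<lambda>k. s (real k * (T / real n))) (T / real n) x0 n) \<longlonglongrightarrow> x T"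
proof -
  have f_cont: "continuous_on UNIV (f i)" if "i \<in> P" for i
    using local_lipschitz_continuous_on[OF f[OF that]] by simp
  have x_cont: "continuous_on {0..T} x"
    using caratheodory_solution_continuous_on[OF sol] by (rule continuous_on_subset) auto
  then obtain R where R: "\<And>t. t \<in> {0..T} \<Longrightarrow> norm (x t) \<le> R"
    using compact_continuous_image[OF x_cont] by (force simp: bounded_iff dest: compact_imp_bounded)
  have "compact (\<Union>i\<in>P. f i ` cball 0 R)"
    using \<open>finite P\<close> f_cont by (intro compact_UN compact_continuous_image) (auto intro: continuous_on_subset)
  then obtain B where B: "\<And>i y. \<lbrakk>i \<in> P; norm y \<le> R\<rbrakk> \<Longrightarrow> norm (f i y) \<le> B"
    by (force simp: bounded_iff dest: compact_imp_bounded)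
  have "\<exists>L. L-lipschitz_on (cball 0 (R + 1)) (f i)" if "i \<in> P" for i
    using local_lipschitz_imp_lipschitz_on_compact[OF f[OF that] compact_cball] by metis
  then obtain l where l: "\<And>i. i \<in> P \<Longrightarrow> (l i)-lipschitz_on (cball 0 (R + 1)) (f i)"
    by metis
  \<comment> \<open>The constants are nonnegative, so their sum dominates each of them and serves
    all modes at once.\<close>
  define L where "L = (\<Sum>i\<in>P. l i)"
  have l_nonneg: "l i \<ge> 0" if "i \<in> P" for i
    using lipschitz_on_nonneg[OF l[OF that]] .
  then have "L \<ge> 0"
    unfolding L_def by (intro sum_nonneg)
  have L: "L-lipschitz_on (cball 0 (R + 1)) (f i)" if "i \<in> P" for i
  proof (rule lipschitz_on_le[OF l[OF that]])
    show "l i \<le> L"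
      unfolding L_def using that l_nonneg \<open>finite P\<close> by (intro member_le_sum) auto
  qed
  define w where "w n k = f (s (real (Suc k) * (T / real n))) (x (real k * (T / real n)))" for n k
  have x_le: "norm (x (real k * (T / real n))) \<le> R" if "k \<le> n" for n k
  proof (rule R)
    have "real k * (T / real n) \<le> real n * (T / real n)"
      using that \<open>T > 0\<close> by (intro mult_right_mono) auto
    then show "real k * (T / real n) \<in> {0..T}"
      using \<open>T > 0\<close> by (auto split: if_splits)
  qed
  have w_bound: "norm (w n k) \<le> B" if "k \<le> n" for n k
    unfolding w_def using x_le[OF that] \<open>T > 0\<close> by (intro B s) auto
  have w_lim: "(\<lambda>n. w n (nat \<lfloor>r * real n / T\<rfloor>)) \<longlonglongrightarrow> f (s r) (x r)" if r: "r \<in> {0..T}" for r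
  proof -
    define k where "k n = nat \<lfloor>r * real n / T\<rfloor>" for n
    have k: "real (k n) = real_of_int \<lfloor>r * real n / T\<rfloor>" for n
      using r \<open>T > 0\<close> by (simp add: k_def)
    have left: "(\<lambda>n. real (k n) * (T / real n)) \<longlonglongrightarrow> r"
      unfolding k by (rule tendsto_floor_grid[OF \<open>T > 0\<close>])
    moreover have "(\<lambda>n. T / real n) \<longlonglongrightarrow> 0"
      by (rule lim_const_over_n)
    ultimately have right: "(\<lambda>n. real (Suc (k n)) * (T / real n)) \<longlonglongrightarrow> r"
      using tendsto_add[of "\<lambda>n. real (k n) * (T / real n)" r _ "\<lambda>n. T / real n" 0]
      by (simp add: algebra_simps)
    have gt: "\<forall>\<^sub>F n in sequentially. real (Suc (k n)) * (T / real n) > r"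
      using eventually_gt_at_top[of 0]
    proof eventually_elim
      case (elim n)
      have "r = (r * real n / T) * (T / real n)"
        using elim \<open>T > 0\<close> by simp
      also have "\<dots> < real (Suc (k n)) * (T / real n)"
        using elim \<open>T > 0\<close> k[of n] by (intro mult_strict_right_mono) (auto, linarith?)
      finally show ?case .
    qed
    have "(\<lambda>n. s (real (Suc (k n)) * (T / real n))) \<longlonglongrightarrow> s r"
      using s_right r by (intro continuous_at_right_imp_right_limits[OF _ right gt]) auto
    \<comment> \<open>Modes carry the discrete topology, so convergence means eventual equality, and
      the vector field can be frozen at \<open>f (s r)\<close>.\<close>
    then have mode: "\<forall>\<^sub>F n in sequentially. s (real (Suc (k n)) * (T / real n)) = s r"
      by (simp add: tendsto_discrete)
    have "\<forall>\<^sub>F n in sequentially. real (k n) * (T / real n) \<in> {0..T}"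
      using eventually_gt_at_top[of 0]
    proof eventually_elim
      case (elim n)
      have "real (k n) * (T / real n) \<le> (r * real n / T) * (T / real n)"
        using \<open>T > 0\<close> unfolding k by (intro mult_right_mono) (linarith, simp)
      also have "\<dots> = r"
        using elim \<open>T > 0\<close> by simp
      finally show ?case
        using r \<open>T > 0\<close> by auto
    qed
    then have "(\<lambda>n. x (real (k n) * (T / real n))) \<longlonglongrightarrow> x r"
      using x_cont r left by (intro continuous_on_tendsto_compose[OF x_cont]) auto
    then have "(\<lambda>n. f (s r) (x (real (k n) * (T / real n)))) \<longlonglongrightarrow> f (s r) (x r)"
      using r s by (intro continuous_on_tendsto_compose[OF f_cont[of "s r"]]) auto
    then show ?thesis
      by (rule Lim_transform_eventually) (use mode in eventually_elim, simp add: w_def k_def)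
  qed
  obtain E where E: "\<And>n k. k < n \<Longrightarrow> norm (x (real (Suc k) * (T / real n)) - x (real k * (T / real n))
        - (T / real n) *\<^sub>R w n k) \<le> E n k"
    and E_lim: "(\<lambda>n. \<Sum>k<n. E n k) \<longlonglongrightarrow> 0"
  proof (rule step_function_defect_tendsto_0[of T "\<lambda>t. f (s t) (x t)" x w B])
    show "((\<lambda>t. f (s t) (x t)) has_integral (x b - x a)) {a..b}" if "0 \<le> a" "a \<le> b" for a b
      using caratheodory_solution_has_integral[OF sol that] .
  qed (use \<open>T > 0\<close> w_lim w_bound in auto)
  have bound_lim: "(\<lambda>n. exp (L * T) * (\<Sum>k<n. E n k)) \<longlonglongrightarrow> 0"
    using tendsto_mult[OF tendsto_const E_lim] by simp
  \<comment> \<open>This provides the smallness hypothesis of \<open>euler_error_bound\<close> for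
    all large \<open>n\<close>.\<close>
  then have "\<forall>\<^sub>F n in sequentially. exp (L * T) * (\<Sum>k<n. E n k) < 1"
    by (rule order_tendstoD) simp
  then have "\<forall>\<^sub>F n in sequentially.
      norm (euler f (\<lambda>k. s (real k * (T / real n))) (T / real n) x0 n - x T)
        \<le> exp (L * T) * (\<Sum>k<n. E n k)"
    using eventually_gt_at_top[of 0]
  proof eventually_elim
    case (elim n)
    have "norm (euler f (\<lambda>k. s (real k * (T / real n))) (T / real n) (x (real 0 * (T / real n))) n
        - x (real n * (T / real n))) \<le> exp (L * (real n * (T / real n))) * (\<Sum>k<n. E n k)"
    proof (rule euler_error_bound[where P = P and R = R and n = n and E = "E n" and X = "\<lambda>k. x (real k * (T / real n))"])
      show "s (real k * (T / real n)) \<in> P" for k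
        using s \<open>T > 0\<close> by simp
      show "exp (L * (real n * (T / real n))) * (\<Sum>k<n. E n k) \<le> 1"
        using elim by simp
    qed (use L \<open>L \<ge> 0\<close> \<open>T > 0\<close> x_le E[unfolded w_def] in simp_all)
    moreover have "x 0 = x0"
      using sol by (simp add: caratheodory_solution_def)
    ultimately show ?case
      using elim by simp
  qed
  then show ?thesis
    by (rule LIM_zero_cancel[OF Lim_null_comparison[OF _ bound_lim]])
qed

section \<open>Measurability of the state at a fixed time\<close>

lemma borel_measurable_switched_solution:
  fixes f :: "nat \<Rightarrow> 'b::euclidean_space \<Rightarrow> 'b"
  assumes "finite P"
    and f: "\<And>i. i \<in> P \<Longrightarrow> local_lipschitz (UNIV :: real set) UNIV (\<lambda>_. f i)"
    and \<sigma>: "\<And>t. t \<ge> 0 \<Longrightarrow> \<sigma> t \<in> M \<rightarrow>\<^sub>M count_space P"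
    and \<sigma>_cadlag: "\<And>\<omega>. \<omega> \<in> space M \<Longrightarrow> cadlag (\<lambda>t. \<sigma> t \<omega>)"
    and sol: "\<And>\<omega>. \<omega> \<in> space M \<Longrightarrow> caratheodory_solution f (\<lambda>t. \<sigma> t \<omega>) x0 (x \<omega>)"
    and "t \<ge> 0"
  shows "(\<lambda>\<omega>. x \<omega> t) \<in> borel_measurable M"
\<comment> \<open>Time 0 is split off because convergence of the polygons is stated for a positive
  horizon; there the state is the constant \<open>x0\<close>.\<close>
proof (cases "t = 0")
  case True
  then have "x \<omega> t = x0" if "\<omega> \<in> space M" for \<omega>
    using sol[OF that] by (simp add: caratheodory_solution_def)
  then show ?thesis
    by (simp cong: measurable_cong)
next
  case False
  show ?thesis
  proof (rule borel_measurable_LIMSEQ_metric)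
    show "(\<lambda>\<omega>. euler f (\<lambda>k. \<sigma> (real k * (t / real n)) \<omega>) (t / real n) x0 n) \<in> borel_measurable M" for n
    proof (rule borel_measurable_euler)
      show "continuous_on UNIV (f i)" if "i \<in> P" for i
        using local_lipschitz_continuous_on[OF f[OF that]] by simp
    qed (use \<sigma> \<open>t \<ge> 0\<close> in auto)
    show "(\<lambda>n. euler f (\<lambda>k. \<sigma> (real k * (t / real n)) \<omega>) (t / real n) x0 n) \<longlonglongrightarrow> x \<omega> t"
      if "\<omega> \<in> space M" for \<omega>
    proof (rule euler_tendsto_solution[OF _ \<open>finite P\<close> _ _ f sol[OF that]])
      show "\<sigma> r \<omega> \<in> P" if "r \<ge> 0" for r
        using measurable_space[OF \<sigma>[OF that] \<open>\<omega> \<in> space M\<close>] by simp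
    qed (use False \<open>t \<ge> 0\<close> \<sigma>_cadlag[OF that] in \<open>auto simp: cadlag_def\<close>)
  qed
qed

section \<open>Events and their probabilities\<close>

text \<open>Exceeding \<open>\<epsilon>\<close> strictly is an open condition, so it persists to the
  right of \<open>t\<close> and holds at a rational time. This turns an uncountable supremum into a
  countable union of events. Moving to the right keeps the rational time in
  \<open>{T..}\<close>.\<close>

lemma sup_norm_from_gt_iff:
  fixes x :: "real \<Rightarrow> 'b::real_normed_vector"
  assumes cont: "continuous_on {T..} x"
  shows "sup_norm_from T x > ereal \<epsilon> \<longleftrightarrow> (\<exists>q\<in>\<rat> \<inter> {T..}. norm (x q) > \<epsilon>)"
proof
  assume "sup_norm_from T x > ereal \<epsilon>"
  then obtain t where t: "t \<ge> T" "norm (x t) > \<epsilon>"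
    by (auto simp: sup_norm_from_def less_SUP_iff)
  have "((\<lambda>u. norm (x u)) \<longlongrightarrow> norm (x t)) (at_right t)"
    using cont t(1) unfolding continuous_on_def
    by (intro tendsto_norm) (rule tendsto_within_subset[of _ _ _ "{T..}"], auto)
  then have "\<forall>\<^sub>F u in at_right t. norm (x u) > \<epsilon>"
    using t(2) order_tendstoD(1) by blast
  then obtain b where b: "b > t" "\<And>u. t < u \<Longrightarrow> u < b \<Longrightarrow> norm (x u) > \<epsilon>"
    unfolding eventually_at_right_field by blast
  obtain q where "q \<in> \<rat>" "t < q" "q < b"
    using Rats_dense_in_real[OF b(1)] by blast
  then show "\<exists>q\<in>\<rat> \<inter> {T..}. norm (x q) > \<epsilon>"
    using b(2) t(1) by (intro bexI[of _ q]) auto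
qed (auto simp: sup_norm_from_def less_SUP_iff)

lemma sets_sup_norm_from_gt:
  fixes x :: "'w \<Rightarrow> real \<Rightarrow> 'b::{real_normed_vector, second_countable_topology}"
  assumes cont: "\<And>\<omega>. \<omega> \<in> space M \<Longrightarrow> continuous_on {T..} (x \<omega>)"
    and meas: "\<And>t. t \<ge> T \<Longrightarrow> (\<lambda>\<omega>. x \<omega> t) \<in> borel_measurable M"
  shows "{\<omega> \<in> space M. sup_norm_from T (x \<omega>) > ereal \<epsilon>} \<in> sets M"
proof -
  have "{\<omega> \<in> space M. sup_norm_from T (x \<omega>) > ereal \<epsilon>}
      = (\<Union>q\<in>\<rat> \<inter> {T..}. {\<omega> \<in> space M. norm (x \<omega> q) > \<epsilon>})"
    using sup_norm_from_gt_iff[OF cont] by auto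
  also have "\<dots> \<in> sets M"
  proof (intro sets.countable_UN'')
    show "countable (\<rat> \<inter> {T..})"
      using countable_rat by blast
    show "{\<omega> \<in> space M. norm (x \<omega> q) > \<epsilon>} \<in> sets M" if "q \<in> \<rat> \<inter> {T..}" for q
    proof -
      have [measurable]: "(\<lambda>\<omega>. x \<omega> q) \<in> borel_measurable M"
        using meas that by simp
      show ?thesis
        by measurable
    qed
  qed
  finally show ?thesis .
qed

section \<open>From almost sure statements to probabilities uniform in the initial state\<close>

text \<open>The indicators tend to 0 almost surely and are dominated by the constant 1, which is
  integrable for a probability measure.\<close>

lemma eventually_notin_imp_measure_tendsto_0:
  assumes "prob_space M"
    and E: "\<And>n. E n \<in> sets M"
    and ev: "AE \<omega> in M. \<forall>\<^sub>F n in sequentially. \<omega> \<notin> E n"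
  shows "(\<lambda>n. measure M (E n)) \<longlonglongrightarrow> 0"
proof -
  interpret prob_space M by fact
  have "(\<lambda>n. \<integral>\<omega>. indicator (E n) \<omega> \<partial>M) \<longlonglongrightarrow> (\<integral>\<omega>. (0 :: real) \<partial>M)"
  proof (rule integral_dominated_convergence[where w = "\<lambda>_. 1"])
    show "AE \<omega> in M. (\<lambda>n. indicator (E n) \<omega>) \<longlonglongrightarrow> (0 :: real)"
      using ev
    proof eventually_elim
      case (elim \<omega>)
      then show ?case
        by (intro tendsto_eventually) (auto elim!: eventually_mono)
    qed
  qed (use E in \<open>auto simp: indicator_def\<close>)
  then show ?thesis
    using E by simp
qed

lemma eventually_not_imp_uniform_prob_le:
  assumes "prob_space M" and "\<eta> > 0"
    and ev: "\<And>y. (\<And>n. Q n (y n)) \<Longrightarrow> AE \<omega> in M. \<forall>\<^sub>F n in sequentially. \<not> A n (y n) \<omega>"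
    and meas: "\<And>n y. {\<omega> \<in> space M. A n y \<omega>} \<in> sets M"
  shows "\<exists>n. \<forall>y. Q n y \<longrightarrow> prob_le M (A n y) \<eta>"
proof (rule ccontr)
  assume "\<not> ?thesis"
  then obtain y where Q: "\<And>n. Q n (y n)" and y: "\<And>n. \<not> prob_le M (A n (y n)) \<eta>"
    by metis
  have "(\<lambda>n. measure M {\<omega> \<in> space M. A n (y n) \<omega>}) \<longlonglongrightarrow> 0"
    using ev[OF Q] by (intro eventually_notin_imp_measure_tendsto_0 assms meas) (auto elim!: eventually_mono)
  then have "\<forall>\<^sub>F n in sequentially. measure M {\<omega> \<in> space M. A n (y n) \<omega>} < \<eta>"
    using \<open>\<eta> > 0\<close> by (rule order_tendstoD)
  then obtain n where "measure M {\<omega> \<in> space M. A n (y n) \<omega>} < \<eta>"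
    using eventually_happens'[OF sequentially_bot] by blast
  then show False
    \<comment> \<open>As the events are measurable, \<open>prob_le\<close> can fail only through a
      probability greater than \<open>\<eta>\<close>.\<close>
    using y[of n] meas by (simp add: prob_le_def)
qed

theorem proposition5p2:
  fixes M :: "'w measure"
    and N :: nat
    and f :: "nat \<Rightarrow> real ^ 'n \<Rightarrow> real ^ 'n"
    and \<sigma> :: "real \<Rightarrow> 'w \<Rightarrow> nat"
    and \<sigma>0 :: nat
    and x :: "real ^ 'n \<Rightarrow> 'w \<Rightarrow> real \<Rightarrow> real ^ 'n"
  assumes "prob_space M" and "complete_measure M"
    and f_lipschitz: "\<And>i. i \<in> {1..N} \<Longrightarrow> local_lipschitz (UNIV :: real set) UNIV (\<lambda>_. f i)"
    and f_zero: "\<And>i. i \<in> {1..N} \<Longrightarrow> f i 0 = 0"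
    and \<sigma>_process: "\<And>t. t \<ge> 0 \<Longrightarrow> \<sigma> t \<in> M \<rightarrow>\<^sub>M count_space {1..N}"
    and \<sigma>_cadlag: "\<And>\<omega>. \<omega> \<in> space M \<Longrightarrow> cadlag (\<lambda>t. \<sigma> t \<omega>)"
    and \<sigma>_init: "\<And>\<omega>. \<omega> \<in> space M \<Longrightarrow> \<sigma> 0 \<omega> = \<sigma>0"
    and x_solution: "\<And>x0 \<omega>. \<omega> \<in> space M \<Longrightarrow>
          caratheodory_solution f (\<lambda>t. \<sigma> t \<omega>) x0 (x x0 \<omega>)"
    and "gas_almost_surely M x"
  shows "strongly_gas_in_probability M x"
proof -
  have event: "{\<omega> \<in> space M. sup_norm_from T (x x0 \<omega>) > ereal \<epsilon>} \<in> sets M" if "T \<ge> 0" for T x0 \<epsilon>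
  proof (rule sets_sup_norm_from_gt)
    show "continuous_on {T..} (x x0 \<omega>)" if "\<omega> \<in> space M" for \<omega>
      using caratheodory_solution_continuous_on[OF x_solution[OF that]]
      by (rule continuous_on_subset) (use \<open>T \<ge> 0\<close> in auto)
    show "(\<lambda>\<omega>. x x0 \<omega> t) \<in> borel_measurable M" if "t \<ge> T" for t
      using \<open>T \<ge> 0\<close> that
      by (intro borel_measurable_switched_solution[OF finite_atLeastAtMost f_lipschitz \<sigma>_process \<sigma>_cadlag x_solution]) auto
  qed
  have AS1: "AE \<omega> in M. \<forall>\<epsilon>>0. \<exists>\<delta>>0. \<forall>x0. norm x0 < \<delta> \<longrightarrow> sup_norm_from 0 (x x0 \<omega>) < ereal \<epsilon>"
    and AS2: "AE \<omega> in M. \<forall>r>0. \<forall>\<epsilon>>0. \<exists>T\<ge>0. \<forall>x0. norm x0 < r \<longrightarrow> sup_norm_from T (x x0 \<omega>) < ereal \<epsilon>"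
    using \<open>gas_almost_surely M x\<close> by (auto simp: gas_almost_surely_def)
  show ?thesis
    unfolding strongly_gas_in_probability_def
  proof (intro conjI ballI allI impI)
    fix \<eta> \<epsilon> :: real assume "\<eta> \<in> {0<..<1}" "\<epsilon> > 0"
    have "\<exists>n. \<forall>x0. norm x0 < 1 / real (Suc n) \<longrightarrow> prob_le M (\<lambda>\<omega>. sup_norm_from 0 (x x0 \<omega>) > ereal \<epsilon>) \<eta>"
    proof (rule eventually_not_imp_uniform_prob_le[OF \<open>prob_space M\<close>])
      fix y :: "nat \<Rightarrow> real ^ 'n" assume y: "\<And>n. norm (y n) < 1 / real (Suc n)"
      show "AE \<omega> in M. \<forall>\<^sub>F n in sequentially. \<not> sup_norm_from 0 (x (y n) \<omega>) > ereal \<epsilon>"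
        using AS1
      proof eventually_elim
        case (elim \<omega>)
        then obtain \<delta> where "\<delta> > 0"
          and \<delta>: "\<And>x0. norm x0 < \<delta> \<Longrightarrow> sup_norm_from 0 (x x0 \<omega>) < ereal \<epsilon>"
          using \<open>\<epsilon> > 0\<close> by blast
        \<comment> \<open>Here \<open>\<delta>\<close> depends on \<open>\<omega>\<close>, but the
          deterministic radii eventually drop below it for each such outcome.\<close>
        have "\<forall>\<^sub>F n in sequentially. 1 / real (Suc n) < \<delta>"
          using \<open>\<delta> > 0\<close> LIMSEQ_Suc[OF lim_const_over_n[of 1]] by (intro order_tendstoD)
        then show ?case
        proof eventually_elim
          case (elim n)
          then show ?case
            using \<delta>[of "y n"] y[of n] by simp
        qed
      qed
    qed (use \<open>\<eta> \<in> {0<..<1}\<close> event in auto)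
    then obtain n where "\<forall>x0. norm x0 < 1 / real (Suc n) \<longrightarrow>
        prob_le M (\<lambda>\<omega>. sup_norm_from 0 (x x0 \<omega>) > ereal \<epsilon>) \<eta>" ..
    then show "\<exists>\<delta>>0. \<forall>x0. norm x0 < \<delta> \<longrightarrow> prob_le M (\<lambda>\<omega>. sup_norm_from 0 (x x0 \<omega>) > ereal \<epsilon>) \<eta>"
      by (intro exI[of _ "1 / real (Suc n)"]) simp
  next
    fix \<eta> r \<epsilon> :: real assume "\<eta> \<in> {0<..<1}" "r > 0" "\<epsilon> > 0"
    \<comment> \<open>The observation times start at \<open>real (Suc n)\<close> because the
      required \<open>T\<close> must be positive.\<close>
    have "\<exists>n. \<forall>x0. norm x0 < r \<longrightarrow> prob_le M (\<lambda>\<omega>. sup_norm_from (real (Suc n)) (x x0 \<omega>) > ereal \<epsilon>) \<eta>"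
    proof (rule eventually_not_imp_uniform_prob_le[OF \<open>prob_space M\<close>])
      fix y :: "nat \<Rightarrow> real ^ 'n" assume y: "\<And>n. norm (y n) < r"
      show "AE \<omega> in M. \<forall>\<^sub>F n in sequentially. \<not> sup_norm_from (real (Suc n)) (x (y n) \<omega>) > ereal \<epsilon>"
        using AS2
      proof eventually_elim
        case (elim \<omega>)
        then obtain T where T: "\<And>x0. norm x0 < r \<Longrightarrow> sup_norm_from T (x x0 \<omega>) < ereal \<epsilon>"
          using \<open>r > 0\<close> \<open>\<epsilon> > 0\<close> by blast
        have "\<forall>\<^sub>F n in sequentially. real n \<ge> T"
          using filterlim_real_sequentially by (auto simp: filterlim_at_top)
        then show ?case
        proof eventually_elim
          case (elim n)
          \<comment> \<open>The supremum decreases as the starting time grows, so the random time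
            \<open>T\<close> may be replaced by any later deterministic one.\<close>
          then have "sup_norm_from (real (Suc n)) (x (y n) \<omega>) \<le> sup_norm_from T (x (y n) \<omega>)"
            unfolding sup_norm_from_def by (intro SUP_subset_mono) auto
          then show ?case
            using T[OF y[of n]] by simp
        qed
      qed
    qed (use \<open>\<eta> \<in> {0<..<1}\<close> event in auto)
    then obtain n where "\<forall>x0. norm x0 < r \<longrightarrow>
        prob_le M (\<lambda>\<omega>. sup_norm_from (real (Suc n)) (x x0 \<omega>) > ereal \<epsilon>) \<eta>" ..
    then show "\<exists>T>0. \<forall>x0. norm x0 < r \<longrightarrow> prob_le M (\<lambda>\<omega>. sup_norm_from T (x x0 \<omega>) > ereal \<epsilon>) \<eta>"
      by (intro exI[of _ "real (Suc n)"]) simp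
  qed
qed

end
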